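(* Let $a,b\in\mathbb{Z}$ be such that $\dfrac{256b^3-27a^4}{\gcd(256b^3,27a^4)}$ is square-free. Suppose $f_{a,b}(x)=x^4+ax+b$ is irreducible over $\mathbb{Q}$ and let $\theta$ be a root. Suppose further that every prime $p$ dividing $\gcd(256b^3,27a^4)$ satisfies one of the following: (1) $p\mid a$ and $p\mid b$, but $p^2\nmid b$; (2) $p=2$, $2\nmid b$, and $(a \bmod 4, b\bmod 4)$ is one of $(0,1)$, $(2,3)$; (3) $p=3$, $3\nmid a$, and $(a\bmod 9,b\bmod 9)$ is one of $(1,3)$, $(1,6)$, $(2,0)$, $(2,3)$, $(4,0)$, $(4,6)$, $(5,0)$, $(5,6)$, $(7,0)$, $(7,3)$, $(8,3)$, $(8,6)$. Then $\mathbb{Q}(\theta)$ is monogenic and $\mathbb{Z}[\theta]$ is the ring of integers of $\mathbb{Q}(\theta)$.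
   Context: A number field $K$ is monogenic if its ring of integers $\mathcal{O}_K$ equals $\mathbb{Z}[\alpha]$ for some $\alpha\in\mathcal{O}_K$. *)

theory Defs
  imports "HOL-Computational_Algebra.Computational_Algebra"
begin

text \<open>
  Number fields are taken as subfields of an arbitrary ambient field of characteristic 0
  (for instance the complex numbers), which is given by a type of class
  \<^class>\<open>field_char_0\<close>.
\<close>

definition is_subfield :: "'a::field set \<Rightarrow> bool" where
  "is_subfield K \<longleftrightarrow>
     1 \<in> K \<and> (\<forall>x\<in>K. \<forall>y\<in>K. x - y \<in> K \<and> x * y \<in> K) \<and> (\<forall>x\<in>K. inverse x \<in> K)"

definition is_number_field :: "'a::field_char_0 set \<Rightarrow> bool" where
  "is_number_field K \<longleftrightarrow>
     is_subfield K \<and>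
     (\<exists>B. finite B \<and> K = module.span (\<lambda>(q::rat) (x::'a). of_rat q * x) B)"

definition ring_of_integers :: "'a::field_char_0 set \<Rightarrow> 'a set" where
  "ring_of_integers K = {x \<in> K. algebraic_int x}"

text \<open>
  The field \<open>\<rat>(\<theta>)\<close>: in characteristic 0 every subfield contains the
  rationals, so the smallest subfield containing \<open>\<theta>\<close> is meant.
\<close>

definition rat_adjoin :: "'a::field_char_0 \<Rightarrow> 'a set" where
  "rat_adjoin \<theta> = \<Inter> {K. is_subfield K \<and> \<theta> \<in> K}"

definition int_adjoin :: "'a::field_char_0 \<Rightarrow> 'a set" where
  "int_adjoin \<alpha> = range (\<lambda>p :: int poly. poly (map_poly of_int p) \<alpha>)"

definition monogenic :: "'a::field_char_0 set \<Rightarrow> bool" where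
  "monogenic K \<longleftrightarrow>
     is_number_field K \<and> (\<exists>\<alpha>\<in>ring_of_integers K. ring_of_integers K = int_adjoin \<alpha>)"

definition f_poly :: "int \<Rightarrow> int \<Rightarrow> int poly" where
  "f_poly a b = [:b, a, 0, 0, 1:]"

end

theory Submission
  imports Defs "Jordan_Normal_Form.Char_Poly" "HOL-Computational_Algebra.Field_as_Ring"
begin

text \<open>
  By a theorem of Euler, \<open>f'(\<theta>) \<alpha> \<in> \<int>[\<theta>]\<close> for every integer \<open>\<alpha>\<close> of \<open>\<rat>(\<theta>)\<close>; in particular
  \<open>D \<alpha> \<in> \<int>[\<theta>]\<close> with \<open>D = 256 b\<^sup>3 - 27 a\<^sup>4\<close>, so it suffices to show for each prime \<open>p\<close> dividing \<open>D\<close>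
  that \<open>p \<alpha> \<in> \<int>[\<theta>]\<close> implies \<open>\<alpha> \<in> \<int>[\<theta>]\<close>. For each such \<open>p\<close> the hypotheses yield an integer \<open>r\<close>
  such that \<open>p\<close> divides \<open>f(r)\<close> exactly once and a power of \<open>\<theta> - r\<close> lies in \<open>(p, f'(\<theta>))\<close>, whence
  \<open>(\<theta> - r)\<^sup>m \<alpha> \<in> \<int>[\<theta>]\<close>. The factors \<open>\<theta> - r\<close> are cancelled one at a time: if \<open>(\<theta> - r) \<alpha>\<close> and \<open>p \<alpha>\<close>
  lie in \<open>\<int>[\<theta>]\<close>, then modulo \<open>\<int>[\<theta>]\<close> one may assume that \<open>s = (\<theta> - r) \<alpha>\<close> is a rational
  integer. Now \<open>f(r)\<close> divides \<open>p s\<close> and, by integrality of \<open>\<alpha>\<close>, a power of \<open>s\<close>. Hence \<open>f(r)\<close>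
  divides \<open>s\<close>, and \<open>\<alpha> = s / (\<theta> - r)\<close> lies in \<open>\<int>[\<theta>]\<close> because \<open>f(r) / (\<theta> - r)\<close> does.
\<close>

section \<open>Sums and products of algebraic integers\<close>

interpretation int_module: Modules.module "\<lambda>(c::int) (x::'a::comm_ring_1). of_int c * x"
  by standard (simp_all add: algebra_simps)

text \<open>The vector of the \<open>v j\<close> is an eigenvector of the integer matrix
  \<open>c\<close> with eigenvalue \<open>x\<close>, nonzero because of \<open>v k\<close>; so
  \<open>x\<close> is a root of a monic integer polynomial, the characteristic polynomial.\<close>

lemma algebraic_int_of_eigen_system:
  fixes x :: "'a::field_char_0" and v :: "nat \<Rightarrow> 'a" and c :: "nat \<Rightarrow> nat \<Rightarrow> int"
  assumes eq: "\<And>i. i < n \<Longrightarrow> x * v i = (\<Sum>j<n. of_int (c i j) * v j)"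
    and "k < n" "v k \<noteq> 0"
  shows "algebraic_int x"
proof -
  define A where "A = mat n n (\<lambda>(i, j). c i j)"
  define B :: "'a mat" where "B = map_mat of_int A"
  have A: "A \<in> carrier_mat n n" and B: "B \<in> carrier_mat n n"
    by (auto simp: A_def B_def)
  have "B *\<^sub>v vec n v = x \<cdot>\<^sub>v vec n v"
    by (rule eq_vecI) (auto simp: A_def B_def scalar_prod_def eq lessThan_atLeast0)
  moreover have "vec n v \<noteq> 0\<^sub>v n"
    using assms by (metis index_vec index_zero_vec(1))
  ultimately have "eigenvalue B x"
    using B by (auto simp: eigenvalue_def eigenvector_def intro!: exI[of _ "vec n v"])
  then have "poly (map_poly of_int (char_poly A)) x = 0"
    using eigenvalue_root_char_poly[OF B] of_int_hom.char_poly_hom[OF A, where 'a = 'a]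
    by (simp add: B_def)
  moreover have "lead_coeff (char_poly A) = 1"
    using degree_monic_char_poly[OF A] by simp
  ultimately show ?thesis
    by (auto simp: algebraic_int_altdef_ipoly)
qed

text \<open>Writing each \<open>x * m\<close> in the generators gives an integer matrix with
  eigenvalue \<open>x\<close>; the entry \<open>z\<close> keeps the eigenvector nonzero.\<close>

lemma algebraic_int_of_stable_module:
  fixes x :: "'a::field_char_0"
  assumes "finite M" "z \<in> M" "z \<noteq> 0"
    and stable: "\<And>m. m \<in> M \<Longrightarrow> x * m \<in> int_module.span M"
  shows "algebraic_int x"
proof -
  obtain v where v: "bij_betw v {..<card M} M"
    using \<open>finite M\<close> ex_bij_betw_nat_finite lessThan_atLeast0 by metis
  have "\<exists>u. x * m = (\<Sum>y\<in>M. of_int (u y) * y)" if "m \<in> M" for m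
    using stable[OF that] unfolding int_module.span_finite[OF \<open>finite M\<close>] by auto
  then obtain u where u: "x * m = (\<Sum>y\<in>M. of_int (u m y) * y)" if "m \<in> M" for m
    by metis
  obtain k where "k < card M" "v k = z"
    using v \<open>z \<in> M\<close> by (metis bij_betw_imp_surj_on imageE lessThan_iff)
  moreover have "x * v i = (\<Sum>j<card M. of_int (u (v i) (v j)) * v j)" if "i < card M" for i
    using u[of "v i"] v that sum.reindex_bij_betw[OF v, of "\<lambda>y. of_int (u (v i) y) * y"]
    by (auto simp: bij_betw_def)
  ultimately show ?thesis
    using \<open>z \<noteq> 0\<close> by (intro algebraic_int_of_eigen_system[of "card M" x v "\<lambda>i j. u (v i) (v j)" k]) auto
qed

lemma algebraic_int_power_eq:
  fixes x :: "'a::field_char_0"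
  assumes "algebraic_int x"
  obtains n and c :: "nat \<Rightarrow> int" where "n > 0" "x ^ n = (\<Sum>i<n. of_int (c i) * x ^ i)"
proof -
  obtain p :: "int poly" where p: "poly (map_poly of_int p) x = 0" "lead_coeff p = 1"
    using assms by (auto simp: algebraic_int_altdef_ipoly)
  \<comment> \<open>A constant monic polynomial is 1 and has no root.\<close>
  have "degree p > 0"
  proof (rule ccontr)
    assume "\<not> degree p > 0"
    then obtain d where "p = [:d:]" by (metis gr0I degree_eq_zeroE)
    with p show False by auto
  qed
  moreover have "x ^ degree p = (\<Sum>i<degree p. of_int (- coeff p i) * x ^ i)"
    using p by (simp add: poly_altdef lessThan_Suc_atMost[symmetric] sum_negf eq_neg_iff_add_eq_0 add.commute)
  ultimately show ?thesis by (rule that)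
qed

lemma span_mult_closed:
  fixes x :: "'a::comm_ring_1"
  assumes "\<And>m. m \<in> M \<Longrightarrow> x * m \<in> int_module.span M" "m \<in> int_module.span M"
  shows "x * m \<in> int_module.span M"
  using assms(2)
proof (induction rule: int_module.span_induct_alt)
  case base
  then show ?case by (simp add: int_module.span_zero)
next
  case (step c y z)
  then have "of_int c * (x * y) + x * z \<in> int_module.span M"
    using assms(1) by (intro int_module.span_add int_module.span_scale)
  then show ?case by (simp add: algebra_simps)
qed

text \<open>The monomials \<open>x ^ i * y ^ j\<close> below the degrees of two monic equations
  suffice: an exponent that reaches the degree is lowered again by the equation.\<close>

lemma algebraic_int_common_module:
  fixes x y :: "'a::field_char_0"
  assumes "algebraic_int x" "algebraic_int y"
  obtains M :: "'a set" where "finite M" "1 \<in> M"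
    "\<And>m. m \<in> M \<Longrightarrow> x * m \<in> int_module.span M" "\<And>m. m \<in> M \<Longrightarrow> y * m \<in> int_module.span M"
proof -
  obtain n c where n: "n > 0" "x ^ n = (\<Sum>i<n. of_int (c i) * x ^ i)"
    using assms(1) by (rule algebraic_int_power_eq)
  obtain k d where k: "k > 0" "y ^ k = (\<Sum>i<k. of_int (d i) * y ^ i)"
    using assms(2) by (rule algebraic_int_power_eq)
  define M where "M = (\<lambda>(i, j). x ^ i * y ^ j) ` ({..<n} \<times> {..<k})"
  have mem: "x ^ i * y ^ j \<in> int_module.span M" if "i < n" "j < k" for i j
    using that by (intro int_module.span_base) (auto simp: M_def)
  show ?thesis
  proof
    show "finite M" by (simp add: M_def)
    show "1 \<in> M" using n k by (auto simp: M_def intro!: image_eqI[of _ _ "(0, 0)"])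
  next
    fix m assume "m \<in> M"
    then obtain i j where m: "m = x ^ i * y ^ j" "i < n" "j < k" by (auto simp: M_def)
    show "x * m \<in> int_module.span M"
    proof (cases "Suc i < n")
      case True
      then show ?thesis using mem[of "Suc i" j] m by (simp add: mult_ac)
    next
      case False
      with m have "x * m = x ^ n * y ^ j"
        by (metis Suc_lessI mult.assoc power_Suc)
      also have "\<dots> = (\<Sum>l<n. of_int (c l) * (x ^ l * y ^ j))"
        by (simp add: n(2) sum_distrib_right mult.assoc)
      also have "\<dots> \<in> int_module.span M"
        using m mem by (intro int_module.span_sum int_module.span_scale) auto
      finally show ?thesis .
    qed
    show "y * m \<in> int_module.span M"
    proof (cases "Suc j < k")
      case True
      then show ?thesis using mem[of i "Suc j"] m by (simp add: mult_ac)
    next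
      case False
      with m have "y * m = y ^ k * x ^ i"
        by (metis Suc_lessI mult.commute mult.assoc power_Suc)
      also have "\<dots> = (\<Sum>l<k. of_int (d l) * (x ^ i * y ^ l))"
        by (simp add: k(2) sum_distrib_left mult_ac)
      also have "\<dots> \<in> int_module.span M"
        using m mem by (intro int_module.span_sum int_module.span_scale) auto
      finally show ?thesis .
    qed
  qed
qed

lemma algebraic_int_add_mult:
  fixes x y :: "'a::field_char_0"
  assumes "algebraic_int x" "algebraic_int y"
  shows algebraic_int_add: "algebraic_int (x + y)" and algebraic_int_mult: "algebraic_int (x * y)"
proof -
  obtain M :: "'a set" where M: "finite M" "1 \<in> M"
    "\<And>m. m \<in> M \<Longrightarrow> x * m \<in> int_module.span M" "\<And>m. m \<in> M \<Longrightarrow> y * m \<in> int_module.span M"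
    using assms by (rule algebraic_int_common_module) blast
  show "algebraic_int (x + y)"
    using M by (intro algebraic_int_of_stable_module[of M 1])
      (auto simp: distrib_right intro: int_module.span_add)
  show "algebraic_int (x * y)"
    using M by (intro algebraic_int_of_stable_module[of M 1])
      (auto simp: mult.assoc intro: span_mult_closed)
qed

lemma algebraic_int_diff:
  fixes x y :: "'a::field_char_0"
  shows "algebraic_int x \<Longrightarrow> algebraic_int y \<Longrightarrow> algebraic_int (x - y)"
  using algebraic_int_add[of x "- y"] by simp

lemma algebraic_int_sum:
  fixes f :: "'b \<Rightarrow> 'a::field_char_0"
  shows "(\<And>i. i \<in> A \<Longrightarrow> algebraic_int (f i)) \<Longrightarrow> algebraic_int (sum f A)"
  by (induction A rule: infinite_finite_induct) (auto intro: algebraic_int_add)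

section \<open>Multiplying integers by the derivative of the minimal polynomial\<close>

interpretation of_rat_poly_hom: map_poly_inj_idom_hom of_rat ..

lemma map_poly_of_rat_of_int: "map_poly of_rat (map_poly of_int p) = map_poly of_int p"
  by (simp add: map_poly_map_poly o_def)

text \<open>Otherwise \<open>f\<close> and \<open>g\<close> are coprime, and a Bezout relation
  evaluated at \<open>x\<close> reads 0 = 1. The field of \<open>x\<close> is arbitrary, so this
  serves both \<theta> and its complex conjugates.\<close>

lemma irreducible_dvd_of_common_root:
  fixes f g :: "rat poly" and x :: "'a::field_char_0"
  assumes "irreducible f" "poly (map_poly of_rat f) x = 0" "poly (map_poly of_rat g) x = 0"
  shows "f dvd g"
proof (rule ccontr)
  assume "\<not> f dvd g"
  then have "Rings.coprime f g"
    using \<open>irreducible f\<close> by (intro prime_elem_imp_coprime irreducible_imp_prime_elem_gcd)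
  moreover obtain u v where "u * f + v * g = gcd f g"
    using bezout_coefficients_fst_snd by blast
  ultimately have "u * f + v * g = 1" by simp
  then have "poly (map_poly of_rat (u * f + v * g)) x = 1" by simp
  with assms show False by (simp add: of_rat_poly_hom.hom_add of_rat_poly_hom.hom_mult)
qed

text \<open>Multiplication by \<open>[:- z, 1:]\<close> turns the coefficients d(i) into d(i-1) - z
  d(i).\<close>

lemma algebraic_int_coeff_prod_linear:
  fixes S :: "'a::field_char_0 set"
  assumes "\<And>z. z \<in> S \<Longrightarrow> algebraic_int z"
  shows "algebraic_int (coeff (\<Prod>z\<in>S. [:- z, 1:]) i)"
  using assms
proof (induction S arbitrary: i rule: infinite_finite_induct)
  case (insert z S)
  then have "algebraic_int (coeff (pCons 0 (\<Prod>z\<in>S. [:- z, 1:])) i -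
      z * coeff (\<Prod>z\<in>S. [:- z, 1:]) i)"
    by (intro algebraic_int_diff algebraic_int_mult) (auto simp: coeff_pCons split: nat.split)
  with insert show ?case by (simp add: add.commute)
qed auto

text \<open>Euler's theorem. The ambient field need not contain all roots of \<open>f\<close>, so
  the conjugates are taken among the complex numbers and the result is carried back to \<theta> by a
  rational polynomial.\<close>

lemma different_mult_integral:
  fixes f :: "int poly" and \<theta> \<alpha> :: "'a::field_char_0" and q :: "rat poly"
  assumes monic: "lead_coeff f = 1"
    and irr: "irreducible (map_poly of_int f :: rat poly)"
    and root: "poly (map_poly of_int f) \<theta> = 0"
    and \<alpha>: "algebraic_int \<alpha>" "\<alpha> = poly (map_poly of_rat q) \<theta>"
  shows "\<exists>F :: int poly. \<alpha> * poly (map_poly of_int (pderiv f)) \<theta> = poly (map_poly of_int F) \<theta>"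
proof -
  define fQ :: "rat poly" where "fQ = map_poly of_int f"
  define fC :: "complex poly" where "fC = map_poly of_int f"
  have irr: "irreducible fQ" using irr by (simp add: fQ_def)
  have fC: "map_poly of_rat fQ = fC"
    by (simp add: fQ_def fC_def map_poly_of_rat_of_int)
  have root: "poly (map_poly of_rat fQ) \<theta> = 0"
    using root by (simp add: fQ_def map_poly_of_rat_of_int)
  have "degree fQ > 0"
    using irr by (metis irreducible_def is_unit_iff_degree not_gr_zero)
  have dfQ: "map_poly of_rat (pderiv fQ) = map_poly of_int (pderiv f)"
    by (simp add: fQ_def of_int_hom.map_poly_pderiv[symmetric] map_poly_of_rat_of_int)
  have dfC: "map_poly of_rat (pderiv fQ) = pderiv fC"
    by (simp add: fC[symmetric] of_rat_hom.map_poly_pderiv)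
  define S where "S = {z. poly fC z = 0}"
  \<comment> \<open>A multiple root would make the irreducible \<open>fQ\<close> divide its own
    derivative, which is nonzero of smaller degree.\<close>
  have "rsquarefree fC"
    unfolding rsquarefree_roots
  proof safe
    fix z assume "poly fC z = 0" "poly (pderiv fC) z = 0"
    then have "fQ dvd pderiv fQ"
      using irreducible_dvd_of_common_root[OF irr, of z "pderiv fQ"] fC dfC by simp
    then show False
      using \<open>degree fQ > 0\<close> dvd_imp_degree_le[of fQ "pderiv fQ"]
      by (simp add: degree_pderiv pderiv_eq_0_iff)
  qed
  then have fC_prod: "fC = (\<Prod>z\<in>S. [:- z, 1:])"
    using complex_poly_decompose_rsquarefree[of fC] monic by (simp add: S_def fC_def)
  have "finite S"
    using poly_roots_finite[of fC] \<open>rsquarefree fC\<close> by (auto simp: S_def rsquarefree_def)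
  have "algebraic_int z" if "z \<in> S" for z
    using that monic by (auto simp: S_def fC_def algebraic_int_altdef_ipoly)
  note S_int = this
  have card_S: "card S = degree fQ"
  proof -
    have "degree fC = card S"
      by (subst fC_prod, subst degree_prod_eq_sum_degree) auto
    then show ?thesis by (simp add: fC_def fQ_def)
  qed

  \<comment> \<open>The \<open>c z\<close> are the conjugates of \<alpha>. They are integral because
    P(q(x)), for \<open>P\<close> a monic equation of \<alpha>, vanishes at \<theta>, hence is
    divisible by \<open>fQ\<close> and vanishes at every \<open>z\<close>.\<close>
  define c where "c = poly (map_poly of_rat q :: complex poly)"
  have c_int: "algebraic_int (c z)" if "z \<in> S" for z
  proof -
    obtain P :: "int poly" where P: "poly (map_poly of_int P) \<alpha> = 0" "lead_coeff P = 1"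
      using \<alpha>(1) by (auto simp: algebraic_int_altdef_ipoly)
    have "poly (map_poly of_rat (pcompose (map_poly of_int P) q)) \<theta> = 0"
      using P \<alpha>(2) by (simp add: of_rat_hom.map_poly_pcompose map_poly_of_rat_of_int poly_pcompose)
    then have "fQ dvd pcompose (map_poly of_int P) q"
      by (rule irreducible_dvd_of_common_root[OF irr root])
    then obtain r where "pcompose (map_poly of_int P) q = fQ * r" by (elim dvdE)
    then have "poly (map_poly of_rat (pcompose (map_poly of_int P) q)) z = 0"
      using that by (simp add: S_def of_rat_poly_hom.hom_mult fC)
    then show ?thesis using P(2)
      by (auto simp: of_rat_hom.map_poly_pcompose map_poly_of_rat_of_int poly_pcompose
          algebraic_int_altdef_ipoly c_def)
  qed

  have lagrange: "poly (\<Sum>z\<in>S. Polynomial.smult (d z) (\<Prod>y\<in>S-{z}. [:- y, 1:])) w =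
      d w * (\<Prod>y\<in>S-{w}. w - y)" if "w \<in> S" for w and d :: "complex \<Rightarrow> complex"
  proof -
    have "poly (\<Sum>z\<in>S. Polynomial.smult (d z) (\<Prod>y\<in>S-{z}. [:- y, 1:])) w =
        (\<Sum>z\<in>S. d z * (\<Prod>y\<in>S-{z}. w - y))"
      by (simp add: poly_sum poly_prod)
    also have "\<dots> = (\<Sum>z\<in>S. if z = w then d w * (\<Prod>y\<in>S-{w}. w - y) else 0)"
      using \<open>finite S\<close> that by (intro sum.cong) (auto intro!: prod_zero bexI[of _ w])
    finally show ?thesis using \<open>finite S\<close> that by simp
  qed
  have deriv: "pderiv fC = (\<Sum>z\<in>S. Polynomial.smult 1 (\<Prod>y\<in>S-{z}. [:- y, 1:]))"
    by (subst fC_prod) (simp add: pderiv_prod pderiv_pCons)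

  txt \<open>By Lagrange interpolation the reduction \<open>F\<close> of \<open>q f'\<close> modulo \<open>f\<close> equals
    \<open>\<Sum>\<^sub>z q(z) f(x) / (x - z)\<close>, so its rational coefficients are algebraic integers.\<close>
  define F where "F = (q * pderiv fQ) mod fQ"
  have F_eq: "q * pderiv fQ = fQ * (q * pderiv fQ div fQ) + F"
    by (simp add: F_def)
  define G where "G = (\<Sum>z\<in>S. Polynomial.smult (c z) (\<Prod>y\<in>S-{z}. [:- y, 1:]))"
  \<comment> \<open>Both sides have degree below \<open>card S\<close> and agree on
    \<open>S\<close>.\<close>
  have "map_poly of_rat F = G"
  proof (rule poly_eqI_degree)
    fix w assume "w \<in> S"
    have "poly (map_poly of_rat (q * pderiv fQ)) w = poly (map_poly of_rat F) w"
      using \<open>w \<in> S\<close> by (subst F_eq) (simp add: of_rat_poly_hom.hom_mult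
          of_rat_poly_hom.hom_add fC S_def)
    then have "poly (map_poly of_rat F) w = c w * poly (pderiv fC) w"
      by (simp add: of_rat_poly_hom.hom_mult dfC c_def)
    then show "poly (map_poly of_rat F) w = poly G w"
      unfolding G_def deriv lagrange[OF \<open>w \<in> S\<close>] by simp
  next
    have "degree F < degree fQ"
      unfolding F_def using \<open>degree fQ > 0\<close> by (metis degree_0 degree_mod_less less_irrefl)
    then show "degree (map_poly of_rat F :: complex poly) < card S"
      by (simp add: card_S)
    have "degree G \<le> card S - 1"
      unfolding G_def
    proof (rule degree_sum_le[OF \<open>finite S\<close>])
      fix z assume "z \<in> S"
      have "degree (Polynomial.smult (c z) (\<Prod>y\<in>S-{z}. [:- y, 1:])) \<le> degree (\<Prod>y\<in>S-{z}. [:- y, 1:])"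
        by (rule degree_smult_le)
      also have "\<dots> = card S - 1"
        using \<open>z \<in> S\<close> \<open>finite S\<close> by (subst degree_prod_eq_sum_degree) auto
      finally show "degree (Polynomial.smult (c z) (\<Prod>y\<in>S-{z}. [:- y, 1:])) \<le> card S - 1" .
    qed
    then show "degree G < card S"
      using \<open>degree fQ > 0\<close> card_S by linarith
  qed
  moreover have "algebraic_int (coeff G i)" for i
    unfolding G_def coeff_sum coeff_smult
    using c_int S_int by (intro algebraic_int_sum algebraic_int_mult
        algebraic_int_coeff_prod_linear) auto
  ultimately have "algebraic_int (of_rat (coeff F i) :: complex)" for i
    by (metis coeff_map_poly of_rat_0)
  then have "(of_rat (coeff F i) :: complex) \<in> \<int>" for i
    by (rule rational_algebraic_int_is_int) simp
  then have "\<exists>k::int. coeff F i = of_int k" for i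
    by (metis Ints_cases of_rat_eq_iff of_rat_of_int_eq)
  then obtain k where k: "\<And>i. coeff F i = of_int (k i)" by metis
  define F' where "F' = Abs_poly (\<lambda>i. k i)"
  have "coeff F' i = k i" for i
  proof -
    have "k i = 0" if "i > degree F" for i
      using coeff_eq_0[OF that] k[of i] by simp
    then show ?thesis
      unfolding F'_def by (subst coeff_Abs_poly[of "degree F"]) auto
  qed
  then have F': "F = map_poly of_int F'"
    by (intro poly_eqI) (simp add: k coeff_map_poly)
  have "poly (map_poly of_rat (q * pderiv fQ)) \<theta> = poly (map_poly of_rat F) \<theta>"
    by (subst F_eq) (simp add: of_rat_poly_hom.hom_mult of_rat_poly_hom.hom_add root)
  then have "\<alpha> * poly (map_poly of_int (pderiv f)) \<theta> = poly (map_poly of_int F') \<theta>"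
    by (simp add: of_rat_poly_hom.hom_mult dfQ \<alpha>(2) F' map_poly_of_rat_of_int)
  then show ?thesis by blast
qed

section \<open>The rings \<open>\<int>[\<theta>]\<close> and \<open>\<rat>(\<theta>)\<close>\<close>

lemma int_adjoin_generator: "\<theta> \<in> int_adjoin \<theta>" for \<theta> :: "'a::field_char_0"
  unfolding int_adjoin_def by (rule range_eqI[of _ _ "[:0, 1:]"]) simp

lemma int_adjoin_of_int: "of_int c \<in> int_adjoin \<theta>" for \<theta> :: "'a::field_char_0"
  unfolding int_adjoin_def by (rule range_eqI[of _ _ "[:c:]"]) (simp add: of_int_hom.map_poly_pCons_hom)

lemma int_adjoin_add: "x \<in> int_adjoin \<theta> \<Longrightarrow> y \<in> int_adjoin \<theta> \<Longrightarrow> x + y \<in> int_adjoin \<theta>"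
  for \<theta> :: "'a::field_char_0"
  unfolding int_adjoin_def by (auto simp flip: of_int_poly_hom.hom_add poly_add)

lemma int_adjoin_mult: "x \<in> int_adjoin \<theta> \<Longrightarrow> y \<in> int_adjoin \<theta> \<Longrightarrow> x * y \<in> int_adjoin \<theta>"
  for \<theta> :: "'a::field_char_0"
  unfolding int_adjoin_def by (auto simp flip: of_int_poly_hom.hom_mult poly_mult)

lemma int_adjoin_diff: "x \<in> int_adjoin \<theta> \<Longrightarrow> y \<in> int_adjoin \<theta> \<Longrightarrow> x - y \<in> int_adjoin \<theta>"
  for \<theta> :: "'a::field_char_0"
  using int_adjoin_add[of x \<theta> "of_int (-1) * y"] int_adjoin_mult[OF int_adjoin_of_int, of y \<theta> "-1"]
  by simp

lemma int_adjoin_power: "x \<in> int_adjoin \<theta> \<Longrightarrow> x ^ n \<in> int_adjoin \<theta>"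
  for \<theta> :: "'a::field_char_0"
  using int_adjoin_of_int[of 1 \<theta>] by (induction n) (auto intro: int_adjoin_mult)

lemma int_adjoin_sum:
  "(\<And>i. i \<in> A \<Longrightarrow> f i \<in> int_adjoin \<theta>) \<Longrightarrow> sum f A \<in> int_adjoin \<theta>"
  for \<theta> :: "'a::field_char_0"
  using int_adjoin_of_int[of 0 \<theta>]
  by (induction A rule: infinite_finite_induct) (auto intro: int_adjoin_add)

lemmas int_adjoin_intros = int_adjoin_generator int_adjoin_of_int int_adjoin_add int_adjoin_mult
  int_adjoin_diff int_adjoin_power int_adjoin_sum

lemma algebraic_int_int_adjoin:
  fixes \<theta> :: "'a::field_char_0"
  assumes "algebraic_int \<theta>" "x \<in> int_adjoin \<theta>"
  shows "algebraic_int x"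
proof -
  have "algebraic_int (poly (map_poly of_int p) \<theta>)" for p :: "int poly"
    by (induction p) (auto intro: algebraic_int_add algebraic_int_mult assms)
  with assms show ?thesis by (auto simp: int_adjoin_def)
qed

text \<open>The ring \<rat>[\<theta>], an explicit description of \<open>rat_adjoin\<close> for
  algebraic \<theta>.\<close>

definition rat_poly_values :: "'a::field_char_0 \<Rightarrow> 'a set" where
  "rat_poly_values \<theta> = range (\<lambda>q :: rat poly. poly (map_poly of_rat q) \<theta>)"

lemma int_adjoin_subset_rat_poly_values: "int_adjoin \<theta> \<subseteq> rat_poly_values \<theta>"
  unfolding int_adjoin_def rat_poly_values_def
proof safe
  fix p :: "int poly"
  show "poly (map_poly of_int p) \<theta> \<in> range (\<lambda>q :: rat poly. poly (map_poly of_rat q) \<theta>)"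
    by (rule range_eqI[of _ _ "map_poly of_int p"]) (simp add: map_poly_of_rat_of_int)
qed

lemma rat_poly_values_ring:
  assumes "x \<in> rat_poly_values \<theta>" "y \<in> rat_poly_values \<theta>"
  shows "x - y \<in> rat_poly_values \<theta>" "x * y \<in> rat_poly_values \<theta>"
    "x + y \<in> rat_poly_values \<theta>"
  using assms unfolding rat_poly_values_def
  by (auto simp flip: of_rat_poly_hom.hom_mult of_rat_poly_hom.hom_minus
      of_rat_poly_hom.hom_add poly_mult poly_diff poly_add)

text \<open>A polynomial with nonzero value at \<theta> is coprime to \<open>f\<close>, so a Bezout
  relation inverts it modulo \<open>f\<close>.\<close>

lemma rat_poly_values_inverse:
  fixes f :: "rat poly"
  assumes "irreducible f" "poly (map_poly of_rat f) \<theta> = 0" "x \<in> rat_poly_values \<theta>"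
  shows "inverse x \<in> rat_poly_values \<theta>"
proof (cases "x = 0")
  case False
  obtain q where q: "x = poly (map_poly of_rat q) \<theta>"
    using assms by (auto simp: rat_poly_values_def)
  have "\<not> f dvd q"
    using False q assms(2) by (auto elim!: dvdE simp: of_rat_poly_hom.hom_mult)
  then have "Rings.coprime f q"
    using \<open>irreducible f\<close> by (intro prime_elem_imp_coprime irreducible_imp_prime_elem_gcd)
  moreover obtain u v where "u * f + v * q = gcd f q"
    using bezout_coefficients_fst_snd by blast
  ultimately have "u * f + v * q = 1" by simp
  then have "poly (map_poly of_rat (u * f + v * q)) \<theta> = 1" by simp
  with assms(2) q have "poly (map_poly of_rat v) \<theta> * x = 1"
    by (simp add: of_rat_poly_hom.hom_mult of_rat_poly_hom.hom_add)
  then have "inverse x = poly (map_poly of_rat v) \<theta>"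
    by (metis inverse_unique mult.commute)
  then show ?thesis by (simp add: rat_poly_values_def)
qed (auto simp: rat_poly_values_def intro: range_eqI[of _ _ 0])

lemma is_subfield_rat_poly_values:
  fixes f :: "rat poly"
  assumes "irreducible f" "poly (map_poly of_rat f) \<theta> = 0"
  shows "is_subfield (rat_poly_values \<theta>)"
  using rat_poly_values_ring rat_poly_values_inverse[OF assms]
    int_adjoin_of_int[of 1 \<theta>] int_adjoin_subset_rat_poly_values[of \<theta>]
  by (auto simp: is_subfield_def)

lemma is_subfield_add:
  assumes "is_subfield K" "x \<in> K" "y \<in> K"
  shows "x + y \<in> K"
proof -
  \<comment> \<open>\<open>is_subfield\<close> speaks of differences only, so 0 is written as 1 -
    1.\<close>
  have "x - ((1 - 1) - y) \<in> K" using assms unfolding is_subfield_def by blast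
  then show ?thesis by simp
qed

lemma is_subfield_of_rat:
  fixes K :: "'a::field_char_0 set"
  assumes "is_subfield K"
  shows "of_rat r \<in> K"
proof -
  have nat: "of_nat n \<in> K" for n
  proof (induction n)
    case 0
    have "1 - 1 \<in> K" using assms unfolding is_subfield_def by blast
    then show ?case by simp
  qed (use assms in \<open>auto simp: is_subfield_def intro: is_subfield_add[OF assms]\<close>)
  have "of_nat 0 - of_nat n \<in> K" for n
    using nat assms unfolding is_subfield_def by blast
  with nat have int: "of_int k \<in> K" for k
    by (cases k rule: int_cases2) auto
  obtain k l where "r = of_int k / of_int l"
    by (metis quotient_of_div surj_pair)
  then have "of_rat r = of_int k * inverse (of_int l :: 'a)"
    by (simp add: of_rat_mult of_rat_inverse divide_inverse)
  then show ?thesis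
    using int assms by (simp add: is_subfield_def)
qed

lemma rat_adjoin_eq_rat_poly_values:
  fixes f :: "rat poly" and \<theta> :: "'a::field_char_0"
  assumes "irreducible f" "poly (map_poly of_rat f) \<theta> = 0"
  shows "rat_adjoin \<theta> = rat_poly_values \<theta>"
proof
  have "\<theta> \<in> rat_poly_values \<theta>"
    using int_adjoin_generator int_adjoin_subset_rat_poly_values by blast
  then show "rat_adjoin \<theta> \<subseteq> rat_poly_values \<theta>"
    using is_subfield_rat_poly_values[OF assms] by (auto simp: rat_adjoin_def)
  have "poly (map_poly of_rat q) \<theta> \<in> K" if K: "is_subfield K" "\<theta> \<in> K" for K q
  proof (induction q)
    case 0
    then show ?case using is_subfield_of_rat[OF K(1), of 0] by simp
  next
    case (pCons c q)
    then have "\<theta> * poly (map_poly of_rat q) \<theta> \<in> K"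
      using K by (simp add: is_subfield_def)
    then show ?case
      using pCons.hyps by (simp add: of_rat_hom.map_poly_pCons_hom is_subfield_add is_subfield_of_rat K)
  qed
  then show "rat_poly_values \<theta> \<subseteq> rat_adjoin \<theta>"
    by (auto simp: rat_adjoin_def rat_poly_values_def)
qed

interpretation rat_module: Modules.module "\<lambda>(q::rat) (x::'a::field_char_0). of_rat q * x"
  by standard (simp_all add: algebra_simps of_rat_add of_rat_mult)

text \<open>Division by \<open>f\<close> leaves a remainder in the powers of \<theta> below
  \<open>degree f\<close>; this gives the finite spanning set of a number field.\<close>

lemma rat_poly_values_eq_span:
  fixes f :: "rat poly" and \<theta> :: "'a::field_char_0"
  assumes "f \<noteq> 0" "poly (map_poly of_rat f) \<theta> = 0"
  shows "rat_poly_values \<theta> = rat_module.span ((\<lambda>i. \<theta> ^ i) ` {..<degree f})"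
proof
  let ?V = "rat_module.span ((\<lambda>i. \<theta> ^ i) ` {..<degree f})"
  show "rat_poly_values \<theta> \<subseteq> ?V"
  proof
    fix x assume "x \<in> rat_poly_values \<theta>"
    then obtain q where q: "x = poly (map_poly of_rat q) \<theta>" by (auto simp: rat_poly_values_def)
    define r where "r = q mod f"
    have "q = f * (q div f) + r" by (simp add: r_def)
    then have "x = poly (map_poly of_rat (f * (q div f) + r)) \<theta>"
      using q by simp
    also have "\<dots> = poly (map_poly of_rat r) \<theta>"
      using assms(2) by (simp add: of_rat_poly_hom.hom_mult of_rat_poly_hom.hom_add)
    also have "\<dots> = (\<Sum>i\<le>degree r. of_rat (coeff r i) * \<theta> ^ i)"
      by (simp add: poly_altdef)
    also have "\<dots> \<in> ?V"
    proof (intro rat_module.span_sum)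
      fix i assume "i \<in> {..degree r}"
      show "of_rat (coeff r i) * \<theta> ^ i \<in> ?V"
      proof (cases "r = 0")
        case False
        with \<open>i \<in> _\<close> have "i < degree f"
          using degree_mod_less[OF \<open>f \<noteq> 0\<close>, of q] by (auto simp: r_def)
        then show ?thesis by (intro rat_module.span_scale rat_module.span_base) auto
      qed (simp add: rat_module.span_zero)
    qed
    finally show "x \<in> ?V" .
  qed
  have const: "of_rat c \<in> rat_poly_values \<theta>" for c
    unfolding rat_poly_values_def by (rule range_eqI[of _ _ "[:c:]"]) (simp add: of_rat_hom.map_poly_pCons_hom)
  have "\<theta> ^ i \<in> rat_poly_values \<theta>" for i
    using int_adjoin_power[OF int_adjoin_generator] int_adjoin_subset_rat_poly_values by blast
  then show "?V \<subseteq> rat_poly_values \<theta>"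
    using rat_poly_values_ring[of _ \<theta>] const const[of 0]
    by (intro rat_module.span_minimal rat_module.subspaceI) auto
qed

lemma is_number_field_rat_adjoin:
  fixes f :: "rat poly" and \<theta> :: "'a::field_char_0"
  assumes "irreducible f" "poly (map_poly of_rat f) \<theta> = 0"
  shows "is_number_field (rat_adjoin \<theta>)"
proof -
  have "f \<noteq> 0" using assms(1) by auto
  then show ?thesis
    using rat_poly_values_eq_span[OF _ assms(2)] is_subfield_rat_poly_values[OF assms]
    by (auto simp: is_number_field_def rat_adjoin_eq_rat_poly_values[OF assms])
qed

section \<open>The quartic \<open>x\<^sup>4 + a x + b\<close>\<close>

text \<open>Synthetic division by x - r: modulo \<theta> - r every element of \<int>[\<theta>] is a
  rational integer.\<close>

lemma int_adjoin_split_value: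
  fixes q :: "int poly" and \<theta> :: "'a::field_char_0"
  obtains y where "y \<in> int_adjoin \<theta>"
    "poly (map_poly of_int q) \<theta> = of_int (poly q r) + (\<theta> - of_int r) * y"
proof
  show "poly (map_poly of_int (synthetic_div q r)) \<theta> \<in> int_adjoin \<theta>"
    by (simp add: int_adjoin_def)
  have "q = [:- r, 1:] * synthetic_div q r + [:poly q r:]"
    by (rule synthetic_div_correct'[symmetric])
  then have "poly (map_poly of_int q) \<theta> =
      poly (map_poly of_int ([:- r, 1:] * synthetic_div q r + [:poly q r:])) \<theta>"
    by (rule arg_cong)
  also have "\<dots> = of_int (poly q r) + (\<theta> - of_int r) * poly (map_poly of_int (synthetic_div q r)) \<theta>"
    by (simp add: of_int_poly_hom.hom_add of_int_poly_hom.hom_mult of_int_hom.map_poly_pCons_hom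
        del: mult_pCons_left)
  finally show "poly (map_poly of_int q) \<theta> =
      of_int (poly q r) + (\<theta> - of_int r) * poly (map_poly of_int (synthetic_div q r)) \<theta>" .
qed

locale quartic =
  fixes a b :: int and \<theta> :: "'a::field_char_0"
  assumes irreducible: "irreducible (map_poly of_int (f_poly a b) :: rat poly)"
    and root: "poly (map_poly of_int (f_poly a b)) \<theta> = 0"
begin

definition "disc = 256 * b ^ 3 - 27 * a ^ 4"

lemma root_pow4: "\<theta> ^ 4 = - of_int a * \<theta> - of_int b"
proof -
  have "of_int b + of_int a * \<theta> + \<theta> ^ 4 = 0"
    using root by (simp add: f_poly_def of_int_hom.map_poly_pCons_hom algebra_simps power4_eq_xxxx)
  then show ?thesis by (simp add: eq_neg_iff_add_eq_0 algebra_simps)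
qed

lemma root_rat: "poly (map_poly of_rat (map_poly of_int (f_poly a b))) \<theta> = 0"
  using root by (simp add: map_poly_of_rat_of_int)

lemma poly_f_poly: "poly (f_poly a b) r = r ^ 4 + a * r + b"
  by (simp add: f_poly_def power4_eq_xxxx algebra_simps)

lemma lead_coeff_f_poly: "lead_coeff (f_poly a b) = 1"
  by (simp add: f_poly_def)

lemma algebraic_int_root: "algebraic_int \<theta>"
  using root lead_coeff_f_poly by (auto simp: algebraic_int_altdef_ipoly)

section \<open>Coordinates in the basis of powers of \<theta>\<close>

lemma int_adjoin_cubic:
  assumes "x \<in> int_adjoin \<theta>"
  obtains c\<^sub>0 c\<^sub>1 c\<^sub>2 c\<^sub>3 :: int
  where "x = of_int c\<^sub>0 + of_int c\<^sub>1 * \<theta> + of_int c\<^sub>2 * \<theta> ^ 2 + of_int c\<^sub>3 * \<theta> ^ 3"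
proof -
  have "\<exists>c\<^sub>0 c\<^sub>1 c\<^sub>2 c\<^sub>3 :: int. poly (map_poly of_int p) \<theta> =
      of_int c\<^sub>0 + of_int c\<^sub>1 * \<theta> + of_int c\<^sub>2 * \<theta> ^ 2 + of_int c\<^sub>3 * \<theta> ^ 3" for p
  proof (induction p)
    case 0
    show ?case by (intro exI[of _ 0]) simp
  next
    case (pCons c p)
    then obtain c\<^sub>0 c\<^sub>1 c\<^sub>2 c\<^sub>3 :: int where IH: "poly (map_poly of_int p) \<theta> =
      of_int c\<^sub>0 + of_int c\<^sub>1 * \<theta> + of_int c\<^sub>2 * \<theta> ^ 2 + of_int c\<^sub>3 * \<theta> ^ 3" by blast
    have "poly (map_poly of_int (pCons c p)) \<theta> =
        of_int c + of_int c\<^sub>0 * \<theta> + of_int c\<^sub>1 * \<theta> ^ 2 + of_int c\<^sub>2 * \<theta> ^ 3 + of_int c\<^sub>3 * \<theta> ^ 4"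
      by (simp add: of_int_hom.map_poly_pCons_hom IH algebra_simps eval_nat_numeral)
    also have "\<dots> = of_int (c - c\<^sub>3 * b) + of_int (c\<^sub>0 - c\<^sub>3 * a) * \<theta> + of_int c\<^sub>1 * \<theta> ^ 2 + of_int c\<^sub>2 * \<theta> ^ 3"
      by (simp add: root_pow4 algebra_simps)
    finally show ?case by blast
  qed
  then show thesis using assms that unfolding int_adjoin_def by blast
qed

text \<open>An irreducible polynomial of degree 4 cannot divide a nonzero one of degree at most
  3.\<close>

lemma powers_independent:
  assumes "of_int c\<^sub>0 + of_int c\<^sub>1 * \<theta> + of_int c\<^sub>2 * \<theta> ^ 2 + of_int c\<^sub>3 * \<theta> ^ 3 = 0"
  shows "c\<^sub>0 = 0 \<and> c\<^sub>1 = 0 \<and> c\<^sub>2 = 0 \<and> c\<^sub>3 = 0"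
proof -
  define p where "p = [:c\<^sub>0, c\<^sub>1, c\<^sub>2, c\<^sub>3:]"
  have "poly (map_poly of_int p) \<theta> = 0"
    using assms by (simp add: p_def of_int_hom.map_poly_pCons_hom algebra_simps eval_nat_numeral)
  then have dvd: "map_poly of_int (f_poly a b) dvd (map_poly of_int p :: rat poly)"
    by (intro irreducible_dvd_of_common_root[OF irreducible root_rat])
      (simp add: map_poly_of_rat_of_int)
  have "p = 0"
  proof (rule ccontr)
    assume "p \<noteq> 0"
    with dvd have "degree (f_poly a b) \<le> degree p"
      using dvd_imp_degree_le[OF dvd] by simp
    moreover have "degree p \<le> 3" by (simp add: p_def)
    moreover have "degree (f_poly a b) = 4" by (simp add: f_poly_def)
    ultimately show False by simp
  qed
  then show ?thesis by (simp add: p_def)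
qed

text \<open>The norm of \<open>\<theta> - r\<close> is \<open>f(r)\<close>, and \<open>\<int>[\<theta>]/(\<theta> - r) \<cong> \<int>/f(r)\<close>.\<close>

lemma int_multiple_of_linear:
  assumes "y \<in> int_adjoin \<theta>" "(\<theta> - of_int r) * y = of_int c"
  shows "poly (f_poly a b) r dvd c"
proof -
  obtain c\<^sub>0 c\<^sub>1 c\<^sub>2 c\<^sub>3 :: int where y:
    "y = of_int c\<^sub>0 + of_int c\<^sub>1 * \<theta> + of_int c\<^sub>2 * \<theta> ^ 2 + of_int c\<^sub>3 * \<theta> ^ 3"
    using assms(1) by (rule int_adjoin_cubic)
  \<comment> \<open>The product is brought back to degree 3 by the equation of \<theta>, so that
    coefficients can be compared.\<close>
  have "of_int (- r * c\<^sub>0 - b * c\<^sub>3 - c) + of_int (c\<^sub>0 - r * c\<^sub>1 - a * c\<^sub>3) * \<theta> +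
      of_int (c\<^sub>1 - r * c\<^sub>2) * \<theta> ^ 2 + of_int (c\<^sub>2 - r * c\<^sub>3) * \<theta> ^ 3 =
      (\<theta> - of_int r) * y - of_int c - of_int c\<^sub>3 * (\<theta> ^ 4 + of_int a * \<theta> + of_int b)"
    unfolding y by (simp add: algebra_simps eval_nat_numeral)
  also have "\<dots> = 0" using assms(2) root_pow4 by simp
  finally have "- r * c\<^sub>0 - b * c\<^sub>3 - c = 0" "c\<^sub>0 - r * c\<^sub>1 - a * c\<^sub>3 = 0" "c\<^sub>1 - r * c\<^sub>2 = 0" "c\<^sub>2 - r * c\<^sub>3 = 0"
    using powers_independent by blast+
  then have "c = - r * c\<^sub>0 - b * c\<^sub>3" "c\<^sub>0 = r * c\<^sub>1 + a * c\<^sub>3" "c\<^sub>1 = r * c\<^sub>2" "c\<^sub>2 = r * c\<^sub>3"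
    by auto
  \<comment> \<open>Back-substitution expresses every coefficient by \<open>c\<^sub>3\<close>; in
    particular \<open>c\<^sub>0\<close> is (r^3 + a) times \<open>c\<^sub>3\<close>.\<close>
  then have "c = poly (f_poly a b) r * (- c\<^sub>3)"
    by (simp add: poly_f_poly algebra_simps eval_nat_numeral)
  then show ?thesis by (rule dvdI)
qed

section \<open>Cancelling factors \<theta> - r\<close>

lemma mem_int_adjoin_of_linear:
  assumes "algebraic_int \<alpha>" "prime p" "of_int p * \<alpha> \<in> int_adjoin \<theta>"
    and "(\<theta> - of_int r) * \<alpha> \<in> int_adjoin \<theta>"
    and "p dvd poly (f_poly a b) r" "\<not> p ^ 2 dvd poly (f_poly a b) r"
  shows "\<alpha> \<in> int_adjoin \<theta>"
proof -
  define N where "N = poly (f_poly a b) r"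
  \<comment> \<open>Splitting f(\<theta>) = 0 at \<open>r\<close> shows that N / (\<theta> - r) = -u
    lies in \<int>[\<theta>].\<close>
  obtain u where u: "u \<in> int_adjoin \<theta>" "(\<theta> - of_int r) * u = - of_int N"
    using int_adjoin_split_value[of \<theta> "f_poly a b" r] root
    by (metis N_def add.commute eq_neg_iff_add_eq_0)
  obtain q :: "int poly" where "(\<theta> - of_int r) * \<alpha> = poly (map_poly of_int q) \<theta>"
    using assms(4) by (auto simp: int_adjoin_def)
  then obtain s y where y: "y \<in> int_adjoin \<theta>" "(\<theta> - of_int r) * \<alpha> = of_int s + (\<theta> - of_int r) * y"
    using int_adjoin_split_value[of \<theta> q r] by metis
  \<comment> \<open>Subtracting \<open>y\<close> does not affect membership in \<int>[\<theta>] and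
    makes (\<theta> - r) \<beta> the rational integer \<open>s\<close>.\<close>
  define \<beta> where "\<beta> = \<alpha> - y"
  have \<beta>: "(\<theta> - of_int r) * \<beta> = of_int s"
    using y by (simp add: \<beta>_def algebra_simps)
  have "algebraic_int \<beta>"
    using assms(1) y(1) algebraic_int_root
    by (auto simp: \<beta>_def intro: algebraic_int_diff algebraic_int_int_adjoin)
  obtain e where e: "N = p * e"
    using assms(5) by (auto simp: N_def elim: dvdE)
  have "N \<noteq> 0" "\<not> p dvd e"
    using assms(6) e by (auto simp: N_def[symmetric] power2_eq_square)
  have "of_int p * \<beta> \<in> int_adjoin \<theta>"
    using assms(3) y(1) by (auto simp: \<beta>_def right_diff_distrib intro!: int_adjoin_intros)
  moreover have "(\<theta> - of_int r) * (of_int p * \<beta>) = of_int (p * s)"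
    using \<beta> by (simp add: mult.left_commute)
  ultimately have "N dvd p * s"
    unfolding N_def by (rule int_multiple_of_linear)
  with e assms(2) have "e dvd s" by auto
  obtain n c where n: "n > 0" "\<beta> ^ n = (\<Sum>i<n. of_int (c i) * \<beta> ^ i)"
    using \<open>algebraic_int \<beta>\<close> by (rule algebraic_int_power_eq)
  \<comment> \<open>The monic equation of \<beta> is multiplied by the n-th power of \<theta> - r.
    As i < n, each term retains one factor \<theta> - r with cofactor in \<int>[\<theta>], whence
    \<open>N dvd s ^ n\<close>.\<close>
  have "of_int (s ^ n) = (\<theta> - of_int r) ^ n * \<beta> ^ n"
    by (simp flip: \<beta> power_mult_distrib)
  also have "\<dots> = (\<Sum>i<n. of_int (c i) * ((\<theta> - of_int r) ^ n * \<beta> ^ i))"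
    by (simp add: n(2) sum_distrib_left mult_ac)
  also have "\<dots> = (\<Sum>i<n. (\<theta> - of_int r) * (of_int (c i) * ((\<theta> - of_int r) ^ (n - i - 1) * of_int s ^ i)))"
  proof (rule sum.cong)
    fix i assume "i \<in> {..<n}"
    then have "n = Suc (n - i - 1 + i)" by auto
    then have "(\<theta> - of_int r) ^ n = (\<theta> - of_int r) * ((\<theta> - of_int r) ^ (n - i - 1) * (\<theta> - of_int r) ^ i)"
      by (metis power_Suc power_add)
    then show "of_int (c i) * ((\<theta> - of_int r) ^ n * \<beta> ^ i) =
        (\<theta> - of_int r) * (of_int (c i) * ((\<theta> - of_int r) ^ (n - i - 1) * of_int s ^ i))"
      by (simp flip: \<beta> add: power_mult_distrib mult_ac)
  qed simp
  finally have "(\<theta> - of_int r) *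
      (\<Sum>i<n. of_int (c i) * ((\<theta> - of_int r) ^ (n - i - 1) * of_int s ^ i)) = of_int (s ^ n)"
    by (simp add: sum_distrib_left)
  then have "N dvd s ^ n"
    unfolding N_def by (intro int_multiple_of_linear) (auto intro!: int_adjoin_intros)
  then have "p dvd s"
    using e assms(2) prime_dvd_power by (metis dvd_mult_left)
  \<comment> \<open>Since \<open>p\<close> divides \<open>N\<close> only once, divisibility of
    \<open>s\<close> by \<open>p\<close> and by \<open>e\<close> combine.\<close>
  moreover have "Rings.coprime p e"
    using assms(2) \<open>\<not> p dvd e\<close> by (simp add: prime_imp_coprime)
  ultimately have "N dvd s"
    using \<open>e dvd s\<close> e by (simp add: divides_mult)
  then obtain t where "s = N * t" by (elim dvdE)
  then have eq: "(\<theta> - of_int r) * \<beta> = (\<theta> - of_int r) * (- u * of_int t)"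
    using \<beta> u(2) by (simp add: mult.assoc[symmetric])
  have "\<theta> - of_int r \<noteq> 0"
    using u(2) \<open>N \<noteq> 0\<close> by auto
  with eq have "\<beta> = - u * of_int t" using mult_left_cancel by blast
  then have "\<alpha> = y - u * of_int t"
    by (simp add: \<beta>_def algebra_simps)
  then show ?thesis
    using y(1) u(1) by (auto intro!: int_adjoin_intros)
qed

text \<open>The element \<beta> is again integral with p \<beta> in \<int>[\<theta>], so the linear
  case strips one factor at a time.\<close>

lemma mem_int_adjoin_of_linear_power:
  assumes "algebraic_int \<alpha>" "prime p" "of_int p * \<alpha> \<in> int_adjoin \<theta>"
    and "(\<theta> - of_int r) ^ m * \<alpha> \<in> int_adjoin \<theta>"
    and "p dvd poly (f_poly a b) r" "\<not> p ^ 2 dvd poly (f_poly a b) r"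
  shows "\<alpha> \<in> int_adjoin \<theta>"
  using assms(4)
proof (induction m)
  case (Suc m)
  define \<beta> where "\<beta> = (\<theta> - of_int r) ^ m * \<alpha>"
  have pow: "(\<theta> - of_int r) ^ m \<in> int_adjoin \<theta>"
    by (intro int_adjoin_intros)
  have "algebraic_int \<beta>"
    unfolding \<beta>_def
    by (rule algebraic_int_mult[OF algebraic_int_int_adjoin[OF algebraic_int_root pow] assms(1)])
  moreover have "of_int p * \<beta> \<in> int_adjoin \<theta>"
    using int_adjoin_mult[OF pow assms(3)] by (simp add: \<beta>_def mult.left_commute)
  moreover have "(\<theta> - of_int r) * \<beta> \<in> int_adjoin \<theta>"
    using Suc.prems by (simp add: \<beta>_def mult.assoc)
  ultimately have "\<beta> \<in> int_adjoin \<theta>"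
    using mem_int_adjoin_of_linear[OF _ assms(2)] assms(5,6) by blast
  then show ?case using Suc.IH by (simp add: \<beta>_def)
qed simp

section \<open>The derivative, the discriminant and good roots\<close>

lemma derivative_mult_integral:
  assumes "algebraic_int \<alpha>" "\<alpha> \<in> rat_poly_values \<theta>"
  shows "(4 * \<theta> ^ 3 + of_int a) * \<alpha> \<in> int_adjoin \<theta>"
proof -
  obtain q where "\<alpha> = poly (map_poly of_rat q) \<theta>"
    using assms(2) by (auto simp: rat_poly_values_def)
  then obtain F :: "int poly" where
    "\<alpha> * poly (map_poly of_int (pderiv (f_poly a b))) \<theta> = poly (map_poly of_int F) \<theta>"
    using different_mult_integral[OF lead_coeff_f_poly irreducible root assms(1)] by blast
  moreover have "poly (map_poly of_int (pderiv (f_poly a b))) \<theta> = 4 * \<theta> ^ 3 + of_int a"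
    by (simp add: f_poly_def pderiv_pCons of_int_hom.map_poly_pCons_hom algebra_simps eval_nat_numeral)
  ultimately show ?thesis by (simp add: int_adjoin_def mult.commute)
qed

lemma disc_mult_integral:
  assumes "algebraic_int \<alpha>" "\<alpha> \<in> rat_poly_values \<theta>"
  shows "of_int disc * \<alpha> \<in> int_adjoin \<theta>"
proof -
  define A B :: 'a where "A = of_int a" and "B = of_int b"
  \<comment> \<open>The cofactor of f' in a Bezout relation that expresses the discriminant by f and
    f'; the cofactor of f appears in the identity below and drops out at \<theta>.\<close>
  define y where "y = - 27 * A ^ 3 - 64 * B ^ 2 * \<theta> + 48 * A * B * \<theta> ^ 2 - 36 * A ^ 2 * \<theta> ^ 3"
  have y: "y \<in> int_adjoin \<theta>"
  proof -
    have "y = of_int (- 27 * a ^ 3) - of_int (64 * b ^ 2) * \<theta> + of_int (48 * a * b) * \<theta> ^ 2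
        - of_int (36 * a ^ 2) * \<theta> ^ 3"
      by (simp add: y_def A_def B_def)
    then show ?thesis by (auto intro!: int_adjoin_intros simp del: of_int_mult of_int_minus)
  qed
  have "y * (4 * \<theta> ^ 3 + A) - (256 * B ^ 3 - 27 * A ^ 4) =
      (\<theta> ^ 4 + A * \<theta> + B) * (- 144 * A ^ 2 * \<theta> ^ 2 + 192 * A * B * \<theta> - 256 * B ^ 2)"
    by (simp add: y_def algebra_simps eval_nat_numeral)
  also have "\<dots> = 0" by (simp add: root_pow4 A_def B_def)
  finally have "of_int disc = y * (4 * \<theta> ^ 3 + of_int a)"
    by (simp add: disc_def A_def B_def)
  then have "of_int disc * \<alpha> = y * ((4 * \<theta> ^ 3 + of_int a) * \<alpha>)"
    by (simp only: mult.assoc)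
  then show ?thesis
    using int_adjoin_mult[OF y derivative_mult_integral[OF assms]] by (simp only:)
qed

text \<open>The prime \<open>p\<close> divides \<open>f(r)\<close> exactly once, and some power of \<open>\<theta> - r\<close> lies in
  the ideal \<open>(p, f'(\<theta>))\<close> of \<open>\<int>[\<theta>]\<close>: then \<open>(p, \<theta> - r)\<close> is the only prime over \<open>p\<close> at which
  \<open>\<int>[\<theta>]\<close> could fail to be maximal, and it is principal locally.\<close>

definition good_root :: "int \<Rightarrow> int \<Rightarrow> bool" where
  "good_root p r \<longleftrightarrow> p dvd poly (f_poly a b) r \<and> \<not> p ^ 2 dvd poly (f_poly a b) r \<and>
     (\<exists>m. \<exists>y\<in>int_adjoin \<theta>. \<exists>z\<in>int_adjoin \<theta>.
        (\<theta> - of_int r) ^ m = (4 * \<theta> ^ 3 + of_int a) * y + of_int p * z)"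

lemma good_rootI:
  assumes "p dvd poly (f_poly a b) r" "\<not> p ^ 2 dvd poly (f_poly a b) r"
    and "y \<in> int_adjoin \<theta>" "z \<in> int_adjoin \<theta>"
    and "(\<theta> - of_int r) ^ m = (4 * \<theta> ^ 3 + of_int a) * y + of_int p * z"
  shows "good_root p r"
  using assms unfolding good_root_def by blast

text \<open>Multiplying the ideal relation of \<open>good_root\<close> by \<alpha> leaves only
  f'(\<theta>) \<alpha> and p \<alpha>, both in \<int>[\<theta>].\<close>

lemma mem_int_adjoin_of_good_root:
  assumes "algebraic_int \<alpha>" "\<alpha> \<in> rat_poly_values \<theta>" "prime p" "of_int p * \<alpha> \<in> int_adjoin \<theta>"
    and "good_root p r"
  shows "\<alpha> \<in> int_adjoin \<theta>"
proof -
  obtain m y z where yz: "y \<in> int_adjoin \<theta>" "z \<in> int_adjoin \<theta>"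
    "(\<theta> - of_int r) ^ m = (4 * \<theta> ^ 3 + of_int a) * y + of_int p * z"
    using assms(5) by (auto simp: good_root_def)
  have "(\<theta> - of_int r) ^ m * \<alpha> = y * ((4 * \<theta> ^ 3 + of_int a) * \<alpha>) + z * (of_int p * \<alpha>)"
    unfolding yz(3) by (simp add: algebra_simps)
  also have "\<dots> \<in> int_adjoin \<theta>"
    by (rule int_adjoin_add[OF int_adjoin_mult[OF yz(1) derivative_mult_integral[OF assms(1,2)]]
          int_adjoin_mult[OF yz(2) assms(4)]])
  finally show ?thesis
    using assms(5) unfolding good_root_def
    by (intro mem_int_adjoin_of_linear_power[OF assms(1,3,4)]) auto
qed

text \<open>By Bezout, \<alpha> is an integer combination of p \<alpha> and \<open>disc\<close>
  times \<alpha>.\<close>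

lemma mem_int_adjoin_of_not_dvd_disc:
  assumes "algebraic_int \<alpha>" "\<alpha> \<in> rat_poly_values \<theta>" "prime p" "of_int p * \<alpha> \<in> int_adjoin \<theta>"
    and "\<not> p dvd disc"
  shows "\<alpha> \<in> int_adjoin \<theta>"
proof -
  have "Rings.coprime p disc"
    using assms by (simp add: prime_imp_coprime)
  then obtain u v where "u * p + v * disc = 1"
    by (metis bezout_int coprime_imp_gcd_eq_1)
  then have "of_int u * (of_int p * \<alpha>) + of_int v * (of_int disc * \<alpha>) = \<alpha>"
    by (metis (no_types) distrib_right mult.assoc mult_1 of_int_1 of_int_add of_int_mult)
  moreover have "of_int u * (of_int p * \<alpha>) + of_int v * (of_int disc * \<alpha>) \<in> int_adjoin \<theta>"
    by (rule int_adjoin_add[OF int_adjoin_mult[OF int_adjoin_of_int assms(4)]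
          int_adjoin_mult[OF int_adjoin_of_int disc_mult_integral[OF assms(1,2)]]])
  ultimately show ?thesis by simp
qed

section \<open>Good roots in each case\<close>

text \<open>Here f is x^4 modulo p, and f(0) = b.\<close>

lemma good_root_eisenstein:
  assumes "p dvd a" "p dvd b" "\<not> p ^ 2 dvd b"
  shows "good_root p 0"
proof -
  obtain a' b' where ab: "a = p * a'" "b = p * b'"
    using assms by (auto elim!: dvdE)
  show ?thesis
  proof (rule good_rootI[where m = 4 and y = "of_int 0" and z = "of_int (- a') * \<theta> - of_int b'"])
    show "of_int (- a') * \<theta> - of_int b' \<in> int_adjoin \<theta>" "of_int 0 \<in> int_adjoin \<theta>"
      by (intro int_adjoin_intros)+
    show "(\<theta> - of_int 0) ^ 4 = (4 * \<theta> ^ 3 + of_int a) * of_int 0 +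
        of_int p * (of_int (- a') * \<theta> - of_int b')"
      by (simp add: root_pow4 ab algebra_simps)
  qed (use assms in \<open>simp_all add: poly_f_poly\<close>)
qed

text \<open>Modulo 2, f is (x - 1)^4; the residues make f(1) = 1 + a + b congruent to 2 modulo
  4.\<close>

lemma good_root_2:
  assumes "(a mod 4, b mod 4) \<in> {(0, 1), (2, 3)}"
  shows "good_root 2 1"
proof -
  have "even a" "odd b" "even (1 + a + b)" "\<not> 4 dvd 1 + a + b"
    using assms by (auto, presburger+)
  then obtain a' b' where ab: "a = 2 * a'" "b = 2 * b' + 1"
    by (auto elim!: evenE oddE)
  \<comment> \<open>Half of (\<theta> - 1)^4 after substituting for \<theta>^4.\<close>
  define z where "z = of_int (- 2) * \<theta> ^ 3 + of_int 3 * \<theta> ^ 2 - of_int (2 + a') * \<theta> - of_int b'"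
  have "z \<in> int_adjoin \<theta>"
    unfolding z_def by (intro int_adjoin_intros)
  moreover have "(\<theta> - of_int 1) ^ 4 = (4 * \<theta> ^ 3 + of_int a) * of_int 0 + of_int 2 * z"
  proof -
    have "(\<theta> - of_int 1) ^ 4 = \<theta> ^ 4 - 4 * \<theta> ^ 3 + 6 * \<theta> ^ 2 - 4 * \<theta> + 1"
      by (simp add: algebra_simps eval_nat_numeral)
    then show ?thesis by (simp add: root_pow4 ab z_def algebra_simps)
  qed
  ultimately show ?thesis
    using \<open>even (1 + a + b)\<close> \<open>\<not> 4 dvd 1 + a + b\<close>
    by (intro good_rootI[where m = 4 and z = z, OF _ _ int_adjoin_of_int[of 0]]) (simp_all add: poly_f_poly)
qed

text \<open>Modulo 3, f' is x^3 + a, which equals (x + a)^3 because a^3 and a are congruent; the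
  residues say that f(-a) is 3 or 6 modulo 9.\<close>

lemma good_root_3:
  assumes "(a mod 9, b mod 9) \<in> {(1, 3), (1, 6), (2, 0), (2, 3), (4, 0), (4, 6),
    (5, 0), (5, 6), (7, 0), (7, 3), (8, 3), (8, 6)}"
  shows "good_root 3 (- a)"
proof -
  define N where "N = a ^ 4 - a * a + b"
  have "N mod 9 =
      (((a mod 9) ^ 4 mod 9 - ((a mod 9) * (a mod 9)) mod 9) mod 9 + b mod 9) mod 9"
    by (simp only: N_def power_mod mod_mult_eq mod_diff_eq mod_add_eq)
  also have "\<dots> = 3 \<or> \<dots> = 6"
    using assms by (elim insertE emptyE) simp_all
  finally have N: "3 dvd N" "\<not> 9 dvd N"
    by presburger+
  have "(a ^ 3 - a) mod 3 = ((a ^ 3) mod 3 - a mod 3) mod 3"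
    by (simp add: mod_simps)
  also have "\<dots> = ((a mod 3) ^ 3 mod 3 - a mod 3) mod 3"
    by (simp only: power_mod)
  also have "\<dots> = 0"
  proof -
    have "a mod 3 = 0 \<or> a mod 3 = 1 \<or> a mod 3 = 2" by presburger
    then show ?thesis by auto
  qed
  finally have "3 dvd a ^ 3 - a" by (simp add: dvd_eq_mod_eq_0)
  then obtain k where k: "a ^ 3 = a + 3 * k" by (auto elim!: dvdE simp: algebra_simps)
  \<comment> \<open>One third of (\<theta> + a)^3 - f'(\<theta>).\<close>
  define z where "z = of_int (- 1) * \<theta> ^ 3 + of_int a * \<theta> ^ 2 + of_int (a ^ 2) * \<theta> + of_int k"
  have "z \<in> int_adjoin \<theta>"
    unfolding z_def by (intro int_adjoin_intros)
  moreover have "(\<theta> - of_int (- a)) ^ 3 = (4 * \<theta> ^ 3 + of_int a) * of_int 1 + of_int 3 * z"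
  proof -
    have cube: "(\<theta> - - A) ^ 3 = \<theta> ^ 3 + 3 * (A * \<theta> ^ 2) + 3 * (A ^ 2 * \<theta>) + A ^ 3" for A :: 'a
      by (simp add: algebra_simps power2_eq_square power3_eq_cube)
    have "(of_int a :: 'a) ^ 3 = of_int a + 3 * of_int k"
      using arg_cong[OF k, of "of_int :: int \<Rightarrow> 'a"] by simp
    with cube[of "of_int a"] show ?thesis by (simp add: z_def algebra_simps)
  qed
  moreover have "poly (f_poly a b) (- a) = N"
    by (simp add: poly_f_poly N_def)
  ultimately show ?thesis
    using N by (intro good_rootI[where m = 3 and z = z, OF _ _ int_adjoin_of_int[of 1]]) simp_all
qed

text \<open>A double root of \<open>f\<close> modulo \<open>p\<close> is a root of \<open>4 f - x f' = 3 a x + 4 b\<close>, which determines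
  \<open>r\<close>; moreover \<open>81 a\<^sup>4 f(-4b/3a) = b (256 b\<^sup>3 - 27 a\<^sup>4)\<close>.\<close>

lemma good_root_simple:
  assumes "prime p" "p dvd disc" "\<not> p ^ 2 dvd disc" "\<not> p dvd 3 * a" "\<not> p dvd b"
  shows "\<exists>r. good_root p r"
proof -
  have "Rings.coprime (3 * a) (p ^ 2)"
    using assms by (metis coprime_commute coprime_power_left_iff prime_imp_coprime)
  \<comment> \<open>The inverse of 3a is taken modulo p^2, not just p, because f(r) has to be
    controlled modulo p^2.\<close>
  then obtain u v where uv: "u * (3 * a) + v * p ^ 2 = 1"
    by (metis bezout_int coprime_imp_gcd_eq_1)
  define r where "r = - 4 * b * u"
  define w where "w = 4 * b * v"
  define N where "N = poly (f_poly a b) r"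
  have ar: "3 * a * r = - 4 * b + p ^ 2 * w"
  proof -
    have "3 * a * r = - 4 * b * (u * (3 * a))" by (simp add: r_def)
    also have "u * (3 * a) = 1 - v * p ^ 2" using uv by simp
    finally show ?thesis by (simp add: w_def algebra_simps)
  qed
  \<comment> \<open>The difference is a polynomial in X = 3ar that vanishes at X = -4b, so X + 4b, a
    multiple of p^2, can be factored out.\<close>
  have "81 * a ^ 4 * N - b * disc =
      ((3 * a * r) ^ 4 - (- 4 * b) ^ 4) + 27 * a ^ 4 * (3 * a * r - (- 4 * b))"
    by (simp add: N_def poly_f_poly disc_def algebra_simps eval_nat_numeral)
  also have "(3 * a * r) ^ 4 - (- 4 * b) ^ 4 =
      (3 * a * r - (- 4 * b)) * ((3 * a * r + (- 4 * b)) * ((3 * a * r) ^ 2 + (- 4 * b) ^ 2))"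
    by (simp add: algebra_simps eval_nat_numeral)
  also have "3 * a * r - (- 4 * b) = p ^ 2 * w"
    unfolding ar by simp
  finally have cong: "p ^ 2 dvd 81 * a ^ 4 * N - b * disc"
    by (simp add: mult.assoc)
  have "p dvd 81 * a ^ 4 * N - b * disc"
    using cong by (metis dvd_mult_left power2_eq_square)
  then have "p dvd 81 * a ^ 4 * N"
    using assms(2) by (metis dvd_diff_left_iff dvd_mult)
  moreover have "81 * a ^ 4 * N = (3 * a) ^ 4 * N" by (simp add: power_mult_distrib)
  ultimately have "p dvd N"
    using assms(1,4) by (metis prime_dvd_mult_iff prime_dvd_power)
  have "\<not> p ^ 2 dvd N"
  proof
    assume "p ^ 2 dvd N"
    then have "p ^ 2 dvd b * disc"
      using cong by (metis dvd_diff_right_iff dvd_mult)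
    moreover have "Rings.coprime (p ^ 2) b"
      using assms by (simp add: prime_imp_coprime)
    ultimately show False using assms(3) by (simp add: coprime_dvd_mult_right_iff)
  qed
  have "good_root p r"
  proof (rule good_rootI[where m = 1 and y = "of_int (- u) * \<theta>" and z = "of_int (p * v) * \<theta>"])
    show "p dvd poly (f_poly a b) r" "\<not> p ^ 2 dvd poly (f_poly a b) r"
      using \<open>p dvd N\<close> \<open>\<not> p ^ 2 dvd N\<close> by (simp_all add: N_def)
    show "of_int (- u) * \<theta> \<in> int_adjoin \<theta>" "of_int (p * v) * \<theta> \<in> int_adjoin \<theta>"
      by (intro int_adjoin_mult int_adjoin_of_int int_adjoin_generator)+
    \<comment> \<open>The equation of \<theta> gives \<theta> f'(\<theta>) = -(3a\<theta> + 4b);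
      multiplied by -u this is \<theta> - r up to a multiple of p^2.\<close>
    have euler: "t - (- 4 * B * U) = (4 * t ^ 3 + A) * (- U * t) + P * (P * V * t)"
      if "t ^ 4 = - A * t - B" "U * (3 * A) = 1 - V * P ^ 2" for t A B U V P :: 'a
    proof -
      have "(4 * t ^ 3 + A) * (- U * t) = - U * (4 * t ^ 4 + A * t)"
        by (simp add: power4_eq_xxxx power3_eq_cube distrib_right distrib_left mult_ac)
      also have "\<dots> = U * (3 * A) * t + 4 * B * U"
        unfolding that(1) by (simp add: algebra_simps)
      finally show ?thesis
        unfolding that(2) by (simp add: algebra_simps power2_eq_square)
    qed
    have "of_int (u * (3 * a)) = (of_int (1 - v * p ^ 2) :: 'a)"
      by (rule arg_cong[of _ _ of_int]) (use uv in linarith)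
    then have "of_int u * (3 * of_int a) = (1 - of_int v * of_int p ^ 2 :: 'a)"
      by (simp only: of_int_mult of_int_diff of_int_power of_int_1 of_int_numeral)
    from euler[OF root_pow4 this] show "(\<theta> - of_int r) ^ 1 =
        (4 * \<theta> ^ 3 + of_int a) * (of_int (- u) * \<theta>) + of_int p * (of_int (p * v) * \<theta>)"
      by (simp only: r_def of_int_mult of_int_minus of_int_numeral power_one_right)
  qed
  then show ?thesis by blast
qed

section \<open>From single primes to the ring of integers\<close>

text \<open>Starting from the multiplier \<open>disc\<close>, prime factors are removed one by one:
  those dividing \<open>disc\<close> by a good root, any others by coprimality.\<close>

lemma integral_mem_int_adjoin:
  assumes "disc \<noteq> 0"
    and good: "\<And>p. prime p \<Longrightarrow> p dvd disc \<Longrightarrow> \<exists>r. good_root p r"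
    and "algebraic_int \<alpha>" "\<alpha> \<in> rat_poly_values \<theta>"
  shows "\<alpha> \<in> int_adjoin \<theta>"
proof -
  have main: "\<alpha> \<in> int_adjoin \<theta>"
    if "N \<noteq> 0" "algebraic_int \<alpha>" "\<alpha> \<in> rat_poly_values \<theta>" "of_int N * \<alpha> \<in> int_adjoin \<theta>"
    for N :: int and \<alpha>
    using that
  proof (induction N arbitrary: \<alpha> rule: prime_divisors_induct)
    case (unit N)
    \<comment> \<open>A unit N is 1 or -1, so its square is 1.\<close>
    then have "\<alpha> = of_int N * (of_int N * \<alpha>)"
      by (auto simp: zdvd1_eq abs_if split: if_splits)
    then show ?case
      using unit by (metis int_adjoin_mult int_adjoin_of_int)
  next
    case (factor p N)
    have "of_int N \<in> rat_poly_values \<theta>"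
      using int_adjoin_of_int int_adjoin_subset_rat_poly_values by blast
    then have "of_int N * \<alpha> \<in> rat_poly_values \<theta>"
      by (rule rat_poly_values_ring(2)[OF _ factor.prems(3)])
    with algebraic_int_mult[OF algebraic_int_of_int factor.prems(2)]
    have N: "algebraic_int (of_int N * \<alpha>)" "of_int N * \<alpha> \<in> rat_poly_values \<theta>"
      by this+
    have pN: "of_int p * (of_int N * \<alpha>) \<in> int_adjoin \<theta>"
      using factor.prems(4) by (simp only: of_int_mult mult.assoc)
    have "of_int N * \<alpha> \<in> int_adjoin \<theta>"
    proof (cases "p dvd disc")
      case True
      then obtain r where "good_root p r" using good[OF factor.hyps(1)] by blast
      then show ?thesis by (rule mem_int_adjoin_of_good_root[OF N factor.hyps(1) pN])
    next
      case False
      then show ?thesis by (rule mem_int_adjoin_of_not_dvd_disc[OF N factor.hyps(1) pN])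
    qed
    moreover have "N \<noteq> 0" using factor.prems(1) by simp
    ultimately show ?case using factor.IH factor.prems(2,3) by blast
  qed simp
  show ?thesis
    by (rule main[OF assms(1,3,4) disc_mult_integral[OF assms(3,4)]])
qed

end

theorem theorem3p1:
  fixes a b :: int and \<theta> :: "'a::field_char_0"
  assumes "squarefree ((256 * b ^ 3 - 27 * a ^ 4) div gcd (256 * b ^ 3) (27 * a ^ 4))"
    and "irreducible (map_poly of_int (f_poly a b) :: rat poly)"
    and "poly (map_poly of_int (f_poly a b)) \<theta> = 0"
    and "\<And>p::int. prime p \<Longrightarrow> p dvd gcd (256 * b ^ 3) (27 * a ^ 4) \<Longrightarrow>
           (p dvd a \<and> p dvd b \<and> \<not> p ^ 2 dvd b) \<or>
           (p = 2 \<and> \<not> 2 dvd b \<and> (a mod 4, b mod 4) \<in> {(0, 1), (2, 3)}) \<or>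
           (p = 3 \<and> \<not> 3 dvd a \<and>
             (a mod 9, b mod 9) \<in> {(1, 3), (1, 6), (2, 0), (2, 3), (4, 0), (4, 6),
                                   (5, 0), (5, 6), (7, 0), (7, 3), (8, 3), (8, 6)})"
  shows "monogenic (rat_adjoin \<theta>) \<and> int_adjoin \<theta> = ring_of_integers (rat_adjoin \<theta>)"
proof -
  interpret quartic a b \<theta> using assms(2,3) by unfold_locales
  define g where "g = gcd (256 * b ^ 3) (27 * a ^ 4)"
  \<comment> \<open>If it were 0, the quotient would be 0, which is not squarefree.\<close>
  have "disc \<noteq> 0"
    using assms(1) by (auto simp: disc_def)
  have "g dvd disc"
    by (simp add: g_def disc_def dvd_diff)
  have good: "\<exists>r. good_root p r" if p: "prime p" "p dvd disc" for p
  proof (cases "p dvd g")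
    case True
    from assms(4)[OF p(1) True[unfolded g_def]] show ?thesis
    proof (elim disjE conjE, goal_cases)
      case 1
      then show ?case by (intro exI[of _ 0] good_root_eisenstein)
    next
      case 2
      show ?case unfolding 2(1) by (rule exI, rule good_root_2[OF 2(3)])
    next
      case 3
      show ?case unfolding 3(1) by (rule exI, rule good_root_3[OF 3(3)])
    qed
  next
    case False
    \<comment> \<open>A divisor of the difference divides both terms or neither, and both would mean
      that p divides \<open>g\<close>.\<close>
    have "p dvd 256 * b ^ 3 \<longleftrightarrow> p dvd 27 * a ^ 4"
      using p(2) unfolding disc_def by (metis dvd_diff_left_iff dvd_diff_right_iff)
    with False have "\<not> p dvd 256 * b ^ 3" "\<not> p dvd 27 * a ^ 4"
      by (auto simp: g_def)
    moreover have "27 * a ^ 4 = 3 * a * (9 * a ^ 3)" "256 * b ^ 3 = b * (256 * b ^ 2)"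
      by (simp_all add: eval_nat_numeral)
    ultimately have "\<not> p dvd 3 * a" "\<not> p dvd b"
      by (metis dvd_mult2)+
    \<comment> \<open>Being coprime to \<open>g\<close>, p^2 would divide the squarefree
      quotient.\<close>
    moreover have "\<not> p ^ 2 dvd disc"
    proof
      assume "p ^ 2 dvd disc"
      moreover have "disc = g * (disc div g)" using \<open>g dvd disc\<close> by simp
      moreover have "Rings.coprime (p ^ 2) g"
        using p False by (simp add: prime_imp_coprime)
      ultimately have "p ^ 2 dvd disc div g"
        by (metis coprime_dvd_mult_right_iff)
      then have "p dvd 1"
        using assms(1) unfolding disc_def g_def by (rule squarefreeD[rotated])
      then show False using p(1) not_prime_unit by blast
    qed
    ultimately show ?thesis using p good_root_simple by blast
  qed
  have K: "rat_adjoin \<theta> = rat_poly_values \<theta>"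
    by (rule rat_adjoin_eq_rat_poly_values[OF irreducible root_rat])
  have ring: "int_adjoin \<theta> = ring_of_integers (rat_adjoin \<theta>)"
    unfolding ring_of_integers_def K
    using int_adjoin_subset_rat_poly_values algebraic_int_int_adjoin[OF algebraic_int_root]
      integral_mem_int_adjoin[OF \<open>disc \<noteq> 0\<close> good] by blast
  moreover have "\<theta> \<in> ring_of_integers (rat_adjoin \<theta>)"
    using int_adjoin_generator unfolding ring[symmetric] .
  ultimately show ?thesis
    using is_number_field_rat_adjoin[OF irreducible root_rat] by (auto simp: monogenic_def)
qed

end
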